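(* Let $\nu\geq 2$ be an integer and let $P(x)=c_{\nu}x^{\nu}+c_{\nu-1}x^{\nu-1}+\cdots+c_1x\in\mathbb{Z}[x]$ have non-zero discriminant. Then for every $\Lambda>0$, $\limsup_{Q\to\infty}\mathcal{S}_{\mathcal{F}_{Q,P}}(\Lambda)$ is finite, and moreover \[\limsup_{Q\to\infty}\mathcal{S}_{\mathcal{F}_{Q,P}}(\Lambda)\ll\int_{0}^{\Lambda}\frac{1}{\lambda^{2}}\sum_{1\leq m<\frac{2\lambda}{\beta_{P}}}h(m)\log\left(\frac{2\lambda}{m\beta_{P}} \right) d\lambda,\] where $\beta_{P}=\prod_p \left(1-\frac{f_{P}(p)}{p^2}\right)$ and $h(m)=\sum_{\substack{n,\delta, d_1,d_2\geq 1\\ n\delta d_1d_2=m}}n f_P(d_1)f_P(d_2)$.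
   Context: For a positive integer $m$, $f_P(m)=\#\{1\le d\le m: P(d)\equiv0\pmod m\}$. $\mathcal{F}_{Q,P}=\{a/q: 1\leq a\leq q\leq Q,\ \gcd(P(a),q)=1\}$ and $\mathcal{N}_{Q,P}=\#\mathcal{F}_{Q,P}$. For $\Lambda>0$, the pair correlation quantity is $\mathcal{S}_{\mathcal{F}_{Q,P}}(\Lambda)=\frac{1}{\mathcal{N}_{Q,P}}\#\{(\gamma_1,\gamma_2)\in\mathcal{F}_{Q,P}^2:\gamma_1\ne\gamma_2,\ \gamma_1-\gamma_2\in\frac{1}{\mathcal{N}_{Q,P}}(0,\Lambda)+\mathbb{Z}\}$. *)

theory Defs
  imports
    "HOL-Analysis.Analysis"
    "HOL-Number_Theory.Cong"
    "HOL-Computational_Algebra.Primes"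
    "Subresultants.Resultant_Prelim"
begin

text \<open>
  Over the integers the division by the leading coefficient is exact: the first column of the
  Sylvester matrix of \<open>P\<close> and its derivative is divisible by it.
\<close>
definition discriminant :: "int poly \<Rightarrow> int" where
  "discriminant P =
     (-1) ^ (degree P * (degree P - 1) div 2) * (resultant P (pderiv P) div lead_coeff P)"

definition root_count :: "int poly \<Rightarrow> nat \<Rightarrow> nat" where
  "root_count P m = card {d::nat. 1 \<le> d \<and> d \<le> m \<and> [poly P (int d) = 0] (mod int m)}"

definition farey_set :: "int poly \<Rightarrow> nat \<Rightarrow> real set" where
  "farey_set P Q =
     {real a / real q | a q :: nat. 1 \<le> a \<and> a \<le> q \<and> q \<le> Q \<and> gcd (poly P (int a)) (int q) = 1}"

definition farey_card :: "int poly \<Rightarrow> nat \<Rightarrow> nat" where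
  "farey_card P Q = card (farey_set P Q)"

definition pair_correlation :: "int poly \<Rightarrow> nat \<Rightarrow> real \<Rightarrow> real" where
  "pair_correlation P Q \<Lambda> =
     1 / real (farey_card P Q) *
     real (card {(\<gamma>\<^sub>1, \<gamma>\<^sub>2). \<gamma>\<^sub>1 \<in> farey_set P Q \<and> \<gamma>\<^sub>2 \<in> farey_set P Q \<and> \<gamma>\<^sub>1 \<noteq> \<gamma>\<^sub>2 \<and>
       (\<exists>t\<in>{0<..<\<Lambda>}. \<exists>k::int. \<gamma>\<^sub>1 - \<gamma>\<^sub>2 = 1 / real (farey_card P Q) * t + of_int k)})"

definition beta_const :: "int poly \<Rightarrow> real" where
  "beta_const P = (\<Prod>p::nat. if prime p then 1 - real (root_count P p) / (real p)\<^sup>2 else 1)"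

definition h_weight :: "int poly \<Rightarrow> nat \<Rightarrow> nat" where
  "h_weight P m = (\<Sum>(n, \<delta>, d\<^sub>1, d\<^sub>2) \<in> {(n, \<delta>, d\<^sub>1, d\<^sub>2). n \<ge> 1 \<and> \<delta> \<ge> 1 \<and> d\<^sub>1 \<ge> 1 \<and> d\<^sub>2 \<ge> 1 \<and>
              n * \<delta> * d\<^sub>1 * d\<^sub>2 = m}. n * root_count P d\<^sub>1 * root_count P d\<^sub>2)"

end

theory Submission
  imports Defs
begin

text \<open>
  Since \<open>P 0 = 0\<close>, the condition \<open>gcd (P a) q = 1\<close> makes \<open>a / q\<close> reduced, so \<open>N\<close> counts pairs
  \<open>(a, q)\<close>; sieving by the primes up to \<open>z\<close> and letting \<open>z\<close> grow gives
  \<open>liminf N / Q\<^sup>2 \<ge> \<beta> / 2\<close>. Only this lower bound on \<open>N\<close> is used.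

  A pair of fractions with denominators \<open>q, r \<le> Q\<close> at distance less than \<open>T / Q\<^sup>2\<close> modulo 1, where
  \<open>T\<close> tends to \<open>U = 2\<Lambda> / \<beta>\<close>, has distance \<open>k / (q r)\<close> with an integer \<open>1 \<le> k < T\<close>. This forces
  \<open>q, r > k Q / T\<close> and \<open>gcd q r dvd k\<close>, and given \<open>q, r, k\<close> there are at most \<open>gcd q r\<close> such pairs,
  whether or not the fractions are reduced. Hence the limsup is at most
  \<open>2 / \<beta>\<close> times the sum over \<open>k < U\<close> and \<open>g dvd k\<close> of \<open>(1 - k / U)\<^sup>2 / g\<close>.

  On the other side, term by term integration turns the integral into \<open>2 / \<beta>\<close> times the sum over
  \<open>m < U\<close> of \<open>h(m) / m * (1 - y + y ln y)\<close> with \<open>y = m / U\<close>. As \<open>h(m)\<close> is at least the divisor sum of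
  \<open>m\<close> and \<open>1 - y + y ln y \<ge> (1 - y)\<^sup>2 / 2\<close>, the constant \<open>C = 2\<close> works.
\<close>

section \<open>Roots of \<open>P\<close> modulo an integer\<close>

lemma root_count_altdef: "root_count P m = card {d \<in> {1..m}. int m dvd poly P (int d)}"
  unfolding root_count_def by (rule arg_cong[where f = card]) (auto simp: cong_0_iff)

lemma root_count_le: "root_count P m \<le> m"
proof -
  have "root_count P m \<le> card {1..m}"
    unfolding root_count_altdef by (rule card_mono) auto
  then show ?thesis by simp
qed

lemma root_count_1 [simp]: "root_count P (Suc 0) = 1"
proof -
  have "{d \<in> {1..Suc 0}. int (Suc 0) dvd poly P (int d)} = {1}" by auto
  then show ?thesis unfolding root_count_altdef by simp
qed

text \<open>Because \<open>x - y\<close> divides \<open>P x - P y\<close>. It gives the periodicity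
  of roots modulo \<open>m\<close>, and with \<open>y = 0\<close> the divisibility of
  \<open>P a\<close> by \<open>a\<close> when \<open>P 0 = 0\<close>.\<close>

lemma dvd_poly_cong:
  fixes P :: "int poly"
  assumes "m dvd x - y"
  shows "m dvd poly P x \<longleftrightarrow> m dvd poly P y"
proof -
  have "x - y dvd poly P x - poly P y"
  proof (induction P)
    case (pCons a P)
    have "poly (pCons a P) x - poly (pCons a P) y = (x - y) * poly P x + y * (poly P x - poly P y)"
      by (simp add: algebra_simps)
    then show ?case using pCons by simp
  qed simp
  then have "m dvd poly P x - poly P y" using assms dvd_trans by blast
  then show ?thesis using dvd_add_right_iff[of m "poly P x - poly P y" "poly P y"] by simp
qed

text \<open>Lagrange's bound over the field with \<open>p\<close> elements, carried out with integer
  coefficients: division by \<open>x - a\<close> at a root \<open>a\<close> leaves a quotient of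
  smaller degree that is still non-zero modulo \<open>p\<close>, and every other root modulo
  \<open>p\<close> is a root of this quotient.\<close>

lemma root_count_prime_le_degree:
  fixes P :: "int poly"
  assumes "prime p" and "\<exists>i. \<not> int p dvd coeff P i"
  shows "root_count P p \<le> degree P"
  using assms(2)
proof (induction "degree P" arbitrary: P rule: less_induct)
  case less
  define R where "R = (\<lambda>P. {d \<in> {1..p}. int p dvd poly P (int d)})"
  have fin: "finite (R P)" for P unfolding R_def by auto
  show ?case
  proof (cases "R P = {}")
    case True
    then show ?thesis unfolding root_count_altdef R_def by (metis card.empty le0)
  next
    case False
    then obtain a where a: "a \<in> R P" by blast
    define S where "S = synthetic_div P (int a)"
    have eq: "P + Polynomial.smult (int a) S = pCons (poly P (int a)) S"
      unfolding S_def by (rule synthetic_div_correct)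
    have pa: "int p dvd poly P (int a)" using a by (simp add: R_def)
    have nS: "\<exists>i. \<not> int p dvd coeff S i"
    proof (rule ccontr)
      assume "\<not> ?thesis"
      then have all: "int p dvd coeff S i" for i by blast
      have "int p dvd coeff P i" for i
      proof -
        have "coeff P i + int a * coeff S i = coeff (pCons (poly P (int a)) S) i"
          using eq by (metis coeff_add coeff_smult)
        moreover have "int p dvd coeff (pCons (poly P (int a)) S) i"
          using all pa by (cases i) auto
        ultimately show ?thesis
          by (metis all dvd_add_left_iff dvd_mult)
      qed
      then show False using less.prems by blast
    qed
    then have "S \<noteq> 0" by auto
    then have dp: "degree P > 0"
      unfolding S_def using synthetic_div_eq_0_iff by blast
    have dS: "degree S = degree P - 1" unfolding S_def by (rule degree_synthetic_div)
    have "R P \<subseteq> insert a (R S)"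
    proof
      fix x assume x: "x \<in> R P"
      show "x \<in> insert a (R S)"
      proof (cases "x = a")
        case False
        have "poly P (int x) + int a * poly S (int x) = poly P (int a) + int x * poly S (int x)"
          using arg_cong[OF eq, of "\<lambda>f. poly f (int x)"] by simp
        then have "(int x - int a) * poly S (int x) = poly P (int x) - poly P (int a)"
          by (simp add: algebra_simps)
        moreover have "int p dvd poly P (int x) - poly P (int a)"
          using x pa by (simp add: R_def)
        ultimately have "int p dvd (int x - int a) * poly S (int x)" by simp
        then have "int p dvd int x - int a \<or> int p dvd poly S (int x)"
          using assms(1) prime_dvd_mult_iff[of "int p"] by simp
        moreover have "\<not> int p dvd int x - int a"
        proof
          assume "int p dvd int x - int a"
          then have "int p \<le> \<bar>int x - int a\<bar>"
            using False dvd_imp_le_int[of "int x - int a" "int p"] by simp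
          moreover have "x \<le> p" "1 \<le> x" "a \<le> p" "1 \<le> a" using x a by (auto simp: R_def)
          ultimately show False by linarith
        qed
        ultimately show ?thesis using x by (auto simp: R_def)
      qed simp
    qed
    then have "card (R P) \<le> card (insert a (R S))" by (intro card_mono) (use fin in auto)
    also have "\<dots> \<le> Suc (card (R S))" by (simp add: card_insert_if fin)
    also have "card (R S) \<le> degree S"
      using less.hyps[of S] dp dS nS unfolding root_count_altdef R_def by simp
    finally show ?thesis using dp dS unfolding root_count_altdef R_def by simp
  qed
qed

text \<open>The Chinese remainder theorem, applied to the residues that are roots.\<close>

lemma root_count_mult:
  assumes "coprime m n" "m > 0" "n > 0"
  shows "root_count P (m * n) = root_count P m * root_count P n"
proof -
  \<comment> \<open>Residues \<open>0..<m\<close> replace \<open>1..m\<close> so that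
    \<open>d mod m\<close> lands in the set; the representative \<open>m\<close> corresponds to
    \<open>0\<close>.\<close>
  define R where "R = (\<lambda>m. {d \<in> {0..<m}. int m dvd poly P (int d)})"
  have per: "int k dvd poly P (int (d mod k)) \<longleftrightarrow> int k dvd poly P (int d)" for k d
    using mod_eq_dvd_iff[of "int (d mod k)" "int k" "int d"]
    by (intro dvd_poly_cong) (simp add: zmod_int)
  have R: "root_count P m = card (R m)" if "m > 0" for m
  proof -
    have "bij_betw (\<lambda>d. d mod m) {d \<in> {1..m}. int m dvd poly P (int d)} (R m)"
    proof (rule bij_betw_byWitness[where f' = "\<lambda>d. if d = 0 then m else d"])
      show "(\<lambda>d. d mod m) ` {d \<in> {1..m}. int m dvd poly P (int d)} \<subseteq> R m"
        unfolding R_def using that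
        by (auto simp: per simp del: of_nat_mod)
      show "(\<lambda>d. if d = 0 then m else d) ` R m \<subseteq> {d \<in> {1..m}. int m dvd poly P (int d)}"
        unfolding R_def using that dvd_poly_cong[of "int m" "int m" 0 P] by auto
      show "\<forall>d\<in>{d \<in> {1..m}. int m dvd poly P (int d)}. (if d mod m = 0 then m else d mod m) = d"
      proof
        fix d assume "d \<in> {d \<in> {1..m}. int m dvd poly P (int d)}"
        then have "1 \<le> d" "d < m \<or> d = m" by auto
        then show "(if d mod m = 0 then m else d mod m) = d" by auto
      qed
      show "\<forall>d\<in>R m. (if d = 0 then m else d) mod m = d" by (auto simp: R_def)
    qed
    then show ?thesis unfolding root_count_altdef by (rule bij_betw_same_card)
  qed
  have "bij_betw (\<lambda>d. (d mod m, d mod n)) (R (m * n)) (R m \<times> R n)"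
  proof (rule bij_betw_imageI)
    show "inj_on (\<lambda>d. (d mod m, d mod n)) (R (m * n))"
    proof (rule inj_onI)
      fix x y assume xy: "x \<in> R (m * n)" "y \<in> R (m * n)" "(x mod m, x mod n) = (y mod m, y mod n)"
      then have "[x = y] (mod m)" "[x = y] (mod n)" by (auto simp: cong_def)
      then have "[x = y] (mod m * n)" using assms(1) coprime_cong_mult_nat by blast
      then show "x = y" using xy by (auto simp: R_def cong_def)
    qed
    show "(\<lambda>d. (d mod m, d mod n)) ` R (m * n) = R m \<times> R n"
    proof
      show "(\<lambda>d. (d mod m, d mod n)) ` R (m * n) \<subseteq> R m \<times> R n"
        using assms by (auto simp: R_def per simp del: of_nat_mod dest: dvd_mult_left dvd_mult_right)
      show "R m \<times> R n \<subseteq> (\<lambda>d. (d mod m, d mod n)) ` R (m * n)"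
      proof clarify
        fix x y assume xy: "x \<in> R m" "y \<in> R n"
        obtain z where z: "z < m * n" "[z = x] (mod m)" "[z = y] (mod n)"
          using binary_chinese_remainder_unique_nat[OF assms(1), of x y] assms by blast
        then have zx: "z mod m = x" "z mod n = y" using xy by (auto simp: R_def cong_def)
        then have "int m dvd poly P (int z)" "int n dvd poly P (int z)"
          using xy per[of m z] per[of n z] by (auto simp: R_def)
        then have "int (m * n) dvd poly P (int z)"
          using assms(1) divides_mult[of "int m" _ "int n"] by simp
        then show "(x, y) \<in> (\<lambda>d. (d mod m, d mod n)) ` R (m * n)"
          using z zx by (auto simp: R_def intro!: image_eqI[where x = z])
      qed
    qed
  qed
  then have "card (R (m * n)) = card (R m) * card (R n)"
    by (simp add: bij_betw_same_card card_cartesian_product)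
  then show ?thesis using assms R by simp
qed

section \<open>Density of pairs sieved by finitely many primes\<close>

lemma card_roots_multiple:
  "card {a \<in> {1..D * j}. int D dvd poly P (int a)} = j * root_count P D"
proof (induction j)
  case (Suc j)
  let ?A = "{a \<in> {1..D * j}. int D dvd poly P (int a)}"
  let ?B = "{a \<in> {1..D}. int D dvd poly P (int a)}"
  \<comment> \<open>Roots modulo \<open>D\<close> have period \<open>D\<close>, so the last block of
    length \<open>D\<close> is a translate of the first.\<close>
  have shift: "int D dvd poly P (int (a + D * j)) \<longleftrightarrow> int D dvd poly P (int a)" for a
    by (rule dvd_poly_cong) simp
  have "{a \<in> {1..D * Suc j}. int D dvd poly P (int a)} = ?A \<union> (\<lambda>a. a + D * j) ` ?B"
  proof (intro equalityI subsetI)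
    fix x assume x: "x \<in> {a \<in> {1..D * Suc j}. int D dvd poly P (int a)}"
    show "x \<in> ?A \<union> (\<lambda>a. a + D * j) ` ?B"
    proof (cases "x \<le> D * j")
      case False
      then have "x = (x - D * j) + D * j" by simp
      moreover have "x - D * j \<in> ?B"
        using x False shift[of "x - D * j"] \<open>x = (x - D * j) + D * j\<close> by auto
      ultimately show ?thesis by blast
    qed (use x in auto)
  next
    fix x assume "x \<in> ?A \<union> (\<lambda>a. a + D * j) ` ?B"
    then consider "x \<in> ?A" | a where "a \<in> ?B" "x = a + D * j" by blast
    then show "x \<in> {a \<in> {1..D * Suc j}. int D dvd poly P (int a)}"
    proof cases
      case 2
      then have "int D dvd poly P (int x)" using shift[of a] by blast
      then show ?thesis using 2 by simp
    qed auto
  qed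
  moreover have "?A \<inter> (\<lambda>a. a + D * j) ` ?B = {}" by auto
  ultimately have "card {a \<in> {1..D * Suc j}. int D dvd poly P (int a)}
      = card ?A + card ((\<lambda>a. a + D * j) ` ?B)"
    by (simp add: card_Un_disjoint)
  also have "card ((\<lambda>a. a + D * j) ` ?B) = card ?B" by (rule card_image) auto
  finally show ?case using Suc unfolding root_count_altdef by simp
qed simp

text \<open>\<open>S\<close> is meant to be a set of sieving primes. The modulus \<open>D\<close> is
  carried along for the induction on \<open>S\<close>: the pairs that a new prime \<open>p\<close>
  removes are again sieved pairs, with \<open>p * D\<close> in place of \<open>D\<close>.\<close>

definition sieved_pairs :: "int poly \<Rightarrow> nat set \<Rightarrow> nat \<Rightarrow> nat \<Rightarrow> (nat \<times> nat) set" where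
  "sieved_pairs P S D Q = {(a, q). 1 \<le> a \<and> a \<le> q \<and> q \<le> Q \<and> D dvd q \<and> int D dvd poly P (int a) \<and>
     (\<forall>p\<in>S. \<not> (p dvd q \<and> int p dvd poly P (int a)))}"

lemma finite_sieved_pairs: "finite (sieved_pairs P S D Q)"
  by (rule finite_subset[of _ "{1..Q} \<times> {1..Q}"]) (auto simp: sieved_pairs_def)

text \<open>For \<open>q = D * j\<close> the values of \<open>a\<close> run through \<open>j\<close>
  full periods, so a triangular number arises; doubling avoids a division.\<close>

lemma card_sieved_pairs_empty:
  assumes "D > 0"
  shows "2 * card (sieved_pairs P {} D Q) = root_count P D * ((Q div D) * (Q div D + 1))"
proof -
  let ?T = "SIGMA j:{1..Q div D}. {a \<in> {1..D * j}. int D dvd poly P (int a)}"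
  have "bij_betw (\<lambda>(j, a). (a, D * j)) ?T (sieved_pairs P {} D Q)"
  proof (rule bij_betw_byWitness[where f' = "\<lambda>(a, q). (q div D, a)"])
    show "(\<lambda>(j, a). (a, D * j)) ` ?T \<subseteq> sieved_pairs P {} D Q"
      using assms by (auto simp: sieved_pairs_def less_eq_div_iff_mult_less_eq mult.commute)
    show "(\<lambda>(a, q). (q div D, a)) ` sieved_pairs P {} D Q \<subseteq> ?T"
      using assms by (auto simp: sieved_pairs_def div_le_mono Suc_le_eq div_greater_zero_iff dest: dvd_imp_le)
  qed (use assms in \<open>auto simp: sieved_pairs_def\<close>)
  then have "card (sieved_pairs P {} D Q) = card ?T" by (simp add: bij_betw_same_card)
  also have "\<dots> = (\<Sum>j\<in>{1..Q div D}. card {a \<in> {1..D * j}. int D dvd poly P (int a)})"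
    by (rule card_SigmaI) auto
  also have "\<dots> = root_count P D * (\<Sum>j\<in>{1..Q div D}. j)"
    unfolding card_roots_multiple by (simp add: sum_distrib_left mult.commute)
  finally have "2 * card (sieved_pairs P {} D Q) = root_count P D * (2 * (\<Sum>j\<in>{1..Q div D}. j))"
    by simp
  then show ?thesis using double_gauss_sum_from_Suc_0[where 'a = nat, of "Q div D"] by simp
qed

lemma tendsto_div_over: "(\<lambda>Q. real (Q div D) / real Q) \<longlonglongrightarrow> 1 / real D"
proof (rule Lim_null_comparison[THEN LIM_zero_cancel])
  show "\<forall>\<^sub>F Q in sequentially. norm (real (Q div D) / real Q - 1 / real D) \<le> 1 / real Q"
    using eventually_gt_at_top[of "0::nat"]
  proof eventually_elim
    case (elim Q)
    have fl: "real (Q div D) = of_int \<lfloor>real Q / real D\<rfloor>"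
      by (simp add: floor_divide_of_nat_eq)
    have "\<bar>real (Q div D) - real Q / real D\<bar> \<le> 1" unfolding fl by linarith
    moreover have "real (Q div D) / real Q - 1 / real D = (real (Q div D) - real Q / real D) / real Q"
      using elim by (simp add: diff_divide_distrib)
    ultimately show ?case using elim by (simp add: divide_right_mono)
  qed
  show "(\<lambda>Q. 1 / real Q) \<longlonglongrightarrow> 0" by (rule lim_1_over_n)
qed

text \<open>Inclusion-exclusion one prime at a time, with \<open>D\<close> left general in the
  induction. The factor 1/2 is the leading coefficient of the triangular numbers.\<close>

lemma sieved_pairs_density:
  assumes "finite S" "\<And>p. p \<in> S \<Longrightarrow> prime p" "D > 0" "\<And>p. p \<in> S \<Longrightarrow> coprime p D"
  shows "(\<lambda>Q. real (card (sieved_pairs P S D Q)) / (real Q)\<^sup>2) \<longlonglongrightarrow>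
           real (root_count P D) / (real D)\<^sup>2 / 2 * (\<Prod>p\<in>S. 1 - real (root_count P p) / (real p)\<^sup>2)"
  using assms
proof (induction S arbitrary: D rule: finite_induct)
  case empty
  let ?f = "\<lambda>Q. real (root_count P D) / 2 * (real (Q div D) / real Q * (real (Q div D) / real Q + 1 / real Q))"
  have "?f \<longlonglongrightarrow> real (root_count P D) / 2 * (1 / real D * (1 / real D + 0))"
    by (intro tendsto_intros tendsto_div_over lim_1_over_n)
  moreover have "real (card (sieved_pairs P {} D Q)) / (real Q)\<^sup>2 = ?f Q" for Q
  proof -
    have "real (2 * card (sieved_pairs P {} D Q)) = real (root_count P D * ((Q div D) * (Q div D + 1)))"
      using card_sieved_pairs_empty[OF empty(2)] by presburger
    then have eq: "real (card (sieved_pairs P {} D Q)) = real (root_count P D) / 2 * (real (Q div D) * (real (Q div D) + 1))"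
      by (simp add: distrib_left)
    show ?thesis unfolding eq by (simp add: power2_eq_square add_divide_distrib[symmetric])
  qed
  ultimately show ?case by (simp add: power2_eq_square mult.commute)
next
  case (insert p S)
  have p: "prime p" "coprime p D" using insert.prems by auto
  then have p0: "p > 0" by (simp add: prime_gt_0_nat)
  have "coprime r p" if "r \<in> S" for r
    using that insert.hyps insert.prems(1) by (metis insert_iff primes_coprime)
  then have cop: "coprime r (p * D)" if "r \<in> S" for r
    using that insert.prems by simp
  have dv: "p * D dvd x \<longleftrightarrow> p dvd x \<and> D dvd x" for x
    using p(2) by (meson divides_mult dvd_mult_left dvd_mult_right)
  have dvi: "int (p * D) dvd x \<longleftrightarrow> int p dvd x \<and> int D dvd x" for x
    using p(2) by (metis coprime_int_iff divides_mult dvd_mult_left dvd_mult_right of_nat_mult)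
  \<comment> \<open>The pairs sieved by \<open>S\<close> split according to whether \<open>p\<close>
    divides both \<open>q\<close> and \<open>P a\<close>.\<close>
  have un: "sieved_pairs P S D Q = sieved_pairs P (insert p S) D Q \<union> sieved_pairs P S (p * D) Q" for Q
    unfolding sieved_pairs_def dv dvi by blast
  have disj: "sieved_pairs P (insert p S) D Q \<inter> sieved_pairs P S (p * D) Q = {}" for Q
    unfolding sieved_pairs_def dv dvi by blast
  have "card (sieved_pairs P S D Q) =
      card (sieved_pairs P (insert p S) D Q) + card (sieved_pairs P S (p * D) Q)" for Q
    by (subst un) (rule card_Un_disjoint[OF finite_sieved_pairs finite_sieved_pairs disj])
  then have eq: "real (card (sieved_pairs P (insert p S) D Q)) / (real Q)\<^sup>2 =
      real (card (sieved_pairs P S D Q)) / (real Q)\<^sup>2 - real (card (sieved_pairs P S (p * D) Q)) / (real Q)\<^sup>2" for Q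
    by (simp add: diff_divide_distrib[symmetric])
  let ?pr = "\<Prod>p\<in>S. 1 - real (root_count P p) / (real p)\<^sup>2"
  have "(\<lambda>Q. real (card (sieved_pairs P (insert p S) D Q)) / (real Q)\<^sup>2) \<longlonglongrightarrow>
     real (root_count P D) / (real D)\<^sup>2 / 2 * ?pr - real (root_count P (p * D)) / (real (p * D))\<^sup>2 / 2 * ?pr"
    unfolding eq
    by (intro tendsto_diff insert.IH) (use insert.prems p0 cop in auto)
  \<comment> \<open>By multiplicativity the removed pairs make up the proportion
    \<open>root_count P p / p^2\<close> of the density before \<open>p\<close> was added, so the
    Euler factor at \<open>p\<close> splits off.\<close>
  moreover have "real (root_count P (p * D)) / (real (p * D))\<^sup>2 =
      real (root_count P p) / (real p)\<^sup>2 * (real (root_count P D) / (real D)\<^sup>2)"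
    using root_count_mult[OF p(2) p0 insert.prems(2)] by (simp add: power_mult_distrib)
  then have "real (root_count P D) / (real D)\<^sup>2 / 2 * ?pr - real (root_count P (p * D)) / (real (p * D))\<^sup>2 / 2 * ?pr =
      real (root_count P D) / (real D)\<^sup>2 / 2 * ((1 - real (root_count P p) / (real p)\<^sup>2) * ?pr)"
    by (simp only:) (simp add: algebra_simps)
  ultimately show ?case
    using insert.hyps by simp
qed

text \<open>Holds for every \<open>Q\<close>, at the price of twice the true density, by
  \<open>m * (m + 1) \<le> 2 * m^2\<close>. Such uniformity is what the primes beyond
  \<open>z\<close> require: they range up to \<open>Q\<close>, so a limit for each single prime
  would not bound their total.\<close>

lemma card_sieved_pairs_empty_le:
  assumes "p > 0"
  shows "real (card (sieved_pairs P {} p Q)) \<le> real (root_count P p) / (real p)\<^sup>2 * (real Q)\<^sup>2"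
proof -
  let ?m = "Q div p"
  have "2 * card (sieved_pairs P {} p Q) \<le> root_count P p * (2 * ?m\<^sup>2)"
    unfolding card_sieved_pairs_empty[OF assms] by (intro mult_left_mono) (cases ?m, auto simp: power2_eq_square)
  then have "card (sieved_pairs P {} p Q) \<le> root_count P p * ?m\<^sup>2" by simp
  then have "real (card (sieved_pairs P {} p Q)) \<le> real (root_count P p) * (real ?m)\<^sup>2"
    by (metis of_nat_le_iff of_nat_mult of_nat_power)
  also have "\<dots> \<le> real (root_count P p) * (real Q / real p)\<^sup>2"
    by (intro mult_left_mono power_mono of_nat_div_le_of_nat) auto
  finally show ?thesis by (simp add: power_divide)
qed

section \<open>Lower bound for the number of fractions\<close>

lemma farey_card_eq:
  assumes "coeff P 0 = 0"
  shows "farey_card P Q =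
    card {(a::nat, q::nat). 1 \<le> a \<and> a \<le> q \<and> q \<le> Q \<and> gcd (poly P (int a)) (int q) = 1}"
    (is "_ = card ?E")
proof -
  have cop: "coprime a q" if "gcd (poly P (int a)) (int q) = 1" for a q :: nat
  proof -
    \<comment> \<open>As \<open>P 0 = 0\<close>, every common divisor of \<open>a\<close> and
      \<open>q\<close> divides both \<open>P a\<close> and \<open>q\<close>.\<close>
    have "int a dvd poly P (int a)"
      using dvd_poly_cong[of "int a" "int a" 0 P] assms by (simp add: poly_0_coeff_0)
    moreover have "coprime (poly P (int a)) (int q)" using that by (simp add: coprime_iff_gcd_eq_1)
    ultimately have "coprime (int a) (int q)" by (meson coprime_divisors dvd_refl)
    then show ?thesis by simp
  qed
  have "inj_on (\<lambda>(a, q). real a / real q) ?E"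
  proof (rule inj_onI)
    fix x y assume xy: "x \<in> ?E" "y \<in> ?E" "(case x of (a, q) \<Rightarrow> real a / real q) = (case y of (a, q) \<Rightarrow> real a / real q)"
    obtain a q b r where x: "x = (a, q)" and y: "y = (b, r)" by fastforce
    have h: "1 \<le> a" "a \<le> q" "1 \<le> b" "b \<le> r" "real a / real q = real b / real r"
      "gcd (poly P (int a)) (int q) = 1" "gcd (poly P (int b)) (int r) = 1"
      using xy unfolding x y by auto
    then have "real a * real r = real b * real q" by (simp add: frac_eq_eq)
    then have "a * r = b * q" by (metis of_nat_eq_iff of_nat_mult)
    then show "x = y"
      using coprime_crossproduct_nat[of a q b r] cop h unfolding x y by (simp add: mult.commute)
  qed
  moreover have "farey_set P Q = (\<lambda>(a, q). real a / real q) ` ?E"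
    unfolding set_eq_iff farey_set_def image_iff Bex_def split_paired_Ex mem_Collect_eq prod.case
    by (simp only: conj_ac simp_thms)
  ultimately show ?thesis unfolding farey_card_def by (simp add: card_image)
qed

text \<open>If a pair survives the primes up to \<open>z\<close> but \<open>P a\<close> and
  \<open>q\<close> are not coprime, they share a prime \<open>p > z\<close>, and
  \<open>p \<le> q \<le> Q\<close> keeps the correction sum finite.\<close>

lemma sieved_pairs_le_farey_card:
  assumes "coeff P 0 = 0"
  shows "card (sieved_pairs P {p. prime p \<and> p \<le> z} 1 Q) \<le>
    farey_card P Q + (\<Sum>p\<in>{p\<in>{Suc z..<Suc Q}. prime p}. card (sieved_pairs P {} p Q))"
proof -
  let ?E = "{(a::nat, q::nat). 1 \<le> a \<and> a \<le> q \<and> q \<le> Q \<and> gcd (poly P (int a)) (int q) = 1}"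
  let ?I = "{p\<in>{Suc z..<Suc Q}. prime p}"
  have fE: "finite ?E" by (rule finite_subset[of _ "{1..Q} \<times> {1..Q}"]) auto
  have "sieved_pairs P {p. prime p \<and> p \<le> z} 1 Q \<subseteq> ?E \<union> (\<Union>p\<in>?I. sieved_pairs P {} p Q)"
  proof clarify
    fix a q assume aq: "(a, q) \<in> sieved_pairs P {p. prime p \<and> p \<le> z} 1 Q"
      and no: "(a, q) \<notin> (\<Union>p\<in>?I. sieved_pairs P {} p Q)"
    have "gcd (poly P (int a)) (int q) = 1"
    proof (rule ccontr)
      assume "gcd (poly P (int a)) (int q) \<noteq> 1"
      then have "nat (gcd (poly P (int a)) (int q)) \<noteq> 1" by simp
      then obtain p where p: "prime p" "p dvd nat (gcd (poly P (int a)) (int q))"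
        using prime_factor_nat by blast
      then have "int p dvd gcd (poly P (int a)) (int q)" 
        by (metis gcd_ge_0_int int_dvd_int_iff nat_0_le)
      then have pd: "int p dvd poly P (int a)" "p dvd q" by (auto simp: gcd_greatest_iff)
      have "q \<le> Q" "1 \<le> a" "a \<le> q" using aq by (auto simp: sieved_pairs_def)
      moreover from this pd have "p \<le> Q" using dvd_imp_le[of p q] by simp
      moreover have "\<not> p \<le> z" using aq pd p by (auto simp: sieved_pairs_def)
      ultimately have "p \<in> ?I" "(a, q) \<in> sieved_pairs P {} p Q"
        using p pd by (auto simp: sieved_pairs_def)
      then show False using no by blast
    qed
    then show "1 \<le> a \<and> a \<le> q \<and> q \<le> Q \<and> gcd (poly P (int a)) (int q) = 1"
      using aq by (auto simp: sieved_pairs_def)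
  qed
  then have "card (sieved_pairs P {p. prime p \<and> p \<le> z} 1 Q) \<le> card (?E \<union> (\<Union>p\<in>?I. sieved_pairs P {} p Q))"
    by (intro card_mono finite_UnI fE) (simp_all add: finite_sieved_pairs)
  also have "\<dots> \<le> card ?E + card (\<Union>p\<in>?I. sieved_pairs P {} p Q)" by (rule card_Un_le)
  also have "card (\<Union>p\<in>?I. sieved_pairs P {} p Q) \<le> (\<Sum>p\<in>?I. card (sieved_pairs P {} p Q))"
    by (rule card_UN_le) simp
  finally show ?thesis unfolding farey_card_eq[OF assms] by simp
qed

text \<open>A prime larger than the absolute value of the leading coefficient does not divide it, so
  Lagrange's bound applies to all large primes and the series is dominated by that of
  \<open>degree P / p^2\<close>.\<close>

lemma summable_root_density:
  assumes "P \<noteq> 0"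
  shows "summable (\<lambda>p. if prime p then real (root_count P p) / (real p)\<^sup>2 else 0)"
proof (rule summable_comparison_test_ev)
  show "summable (\<lambda>p. real (degree P) * inverse ((real p)\<^sup>2))"
    by (intro summable_mult inverse_power_summable) simp
  show "\<forall>\<^sub>F p in sequentially. norm (if prime p then real (root_count P p) / (real p)\<^sup>2 else 0)
      \<le> real (degree P) * inverse ((real p)\<^sup>2)"
    using eventually_gt_at_top[of "nat \<bar>lead_coeff P\<bar>"]
  proof eventually_elim
    case (elim p)
    have "root_count P p \<le> degree P" if "prime p"
    proof (rule root_count_prime_le_degree[OF that])
      have "\<not> int p dvd lead_coeff P"
        using elim assms dvd_imp_le_int[of "lead_coeff P" "int p"] by auto
      then show "\<exists>i. \<not> int p dvd coeff P i" by blast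
    qed
    then show ?case by (auto simp: divide_inverse intro!: mult_right_mono)
  qed
qed

lemma root_density_less_1:
  assumes "prime p"
  shows "real (root_count P p) / (real p)\<^sup>2 < 1"
proof -
  have "p > 1" using assms by (rule prime_gt_1_nat)
  then have "p < p\<^sup>2" by (simp add: power2_eq_square)
  then have "root_count P p < p\<^sup>2" using root_count_le[of P p] by linarith
  then have "real (root_count P p) < (real p)\<^sup>2" by (metis of_nat_less_iff of_nat_power)
  then show ?thesis using \<open>p > 1\<close> by simp
qed

lemma convergent_prod_beta:
  assumes "P \<noteq> 0"
  shows "convergent_prod (\<lambda>p. if prime p then 1 - real (root_count P p) / (real p)\<^sup>2 else 1)"
proof (rule abs_convergent_prod_imp_convergent_prod)
  have "(\<lambda>p. norm ((if prime p then 1 - real (root_count P p) / (real p)\<^sup>2 else 1) - 1)) =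
      (\<lambda>p. if prime p then real (root_count P p) / (real p)\<^sup>2 else 0)" by auto
  then show "abs_convergent_prod (\<lambda>p. if prime p then 1 - real (root_count P p) / (real p)\<^sup>2 else 1)"
    unfolding abs_convergent_prod_conv_summable using summable_root_density[OF assms] by simp
qed

lemma beta_const_pos:
  assumes "P \<noteq> 0"
  shows "beta_const P > 0"
  unfolding beta_const_def using root_density_less_1
  by (intro less_0_prodinf convergent_prod_beta[OF assms]) auto

text \<open>All factors lie between 0 and 1, so the partial products decrease to the infinite
  product.\<close>

lemma beta_const_le_prod:
  assumes "P \<noteq> 0"
  shows "beta_const P \<le> (\<Prod>p | prime p \<and> p \<le> z. 1 - real (root_count P p) / (real p)\<^sup>2)"
proof -
  let ?F = "\<lambda>p. if prime p then 1 - real (root_count P p) / (real p)\<^sup>2 else 1"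
  have 01: "0 \<le> ?F p" "?F p \<le> 1" for p using root_density_less_1[of p P] by auto
  have "beta_const P \<le> (\<Prod>p<Suc z. ?F p)"
    unfolding beta_const_def
    by (rule prod_ge_prodinf[OF convergent_prod_has_prod[OF convergent_prod_beta[OF assms]]])
      (use 01 in auto)
  also have "\<dots> = (\<Prod>p | prime p \<and> p \<le> z. 1 - real (root_count P p) / (real p)\<^sup>2)"
    by (rule prod.mono_neutral_cong_right) auto
  finally show ?thesis .
qed

text \<open>First \<open>z\<close> is fixed, then \<open>Q\<close> grows. Sieving up to
  \<open>z\<close> leaves density at least \<open>beta_const P / 2\<close>, and the larger primes
  remove at most the tail of a convergent series.\<close>

lemma eventually_farey_card_ge:
  assumes "coeff P 0 = 0" "P \<noteq> 0" "b < beta_const P / 2"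
  shows "\<forall>\<^sub>F Q in sequentially. b * (real Q)\<^sup>2 \<le> real (farey_card P Q)"
proof -
  define g where "g = (\<lambda>p. if prime p then real (root_count P p) / (real p)\<^sup>2 else 0)"
  \<comment> \<open>Half of the available gap: one \<open>e\<close> pays for the convergence of the
    sieved density, the other for the tail beyond \<open>z\<close>.\<close>
  define e where "e = (beta_const P / 2 - b) / 2"
  have e: "e > 0" using assms by (simp add: e_def)
  have "summable g" unfolding g_def by (rule summable_root_density[OF assms(2)])
  then obtain z where z: "\<And>m n. m \<ge> z \<Longrightarrow> norm (sum g {m..<n}) < e"
    using e unfolding summable_Cauchy by blast
  let ?W = "\<lambda>Q. real (card (sieved_pairs P {p. prime p \<and> p \<le> z} 1 Q))"
  have "(\<lambda>Q. ?W Q / (real Q)\<^sup>2) \<longlonglongrightarrow> real (root_count P 1) / (real 1)\<^sup>2 / 2 *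
      (\<Prod>p | prime p \<and> p \<le> z. 1 - real (root_count P p) / (real p)\<^sup>2)"
    by (rule sieved_pairs_density) auto
  moreover have "beta_const P / 2 - e < real (root_count P 1) / (real 1)\<^sup>2 / 2 *
      (\<Prod>p | prime p \<and> p \<le> z. 1 - real (root_count P p) / (real p)\<^sup>2)"
    using beta_const_le_prod[OF assms(2), of z] e by simp
  ultimately have "\<forall>\<^sub>F Q in sequentially. beta_const P / 2 - e < ?W Q / (real Q)\<^sup>2"
    by (rule order_tendstoD)
  then show ?thesis using eventually_gt_at_top[of 0]
  proof eventually_elim
    case (elim Q)
    let ?I = "{p\<in>{Suc z..<Suc Q}. prime p}"
    have "(\<Sum>p\<in>?I. real (card (sieved_pairs P {} p Q))) \<le> (\<Sum>p\<in>?I. g p * (real Q)\<^sup>2)"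
      
    proof (rule sum_mono)
      fix p assume "p \<in> ?I"
      then show "real (card (sieved_pairs P {} p Q)) \<le> g p * (real Q)\<^sup>2"
        using card_sieved_pairs_empty_le[of p P Q] by (simp add: g_def)
    qed
    also have "\<dots> = (\<Sum>p\<in>?I. g p) * (real Q)\<^sup>2" by (simp add: sum_distrib_right)
    also have "(\<Sum>p\<in>?I. g p) = sum g {Suc z..<Suc Q}"
      by (rule sum.mono_neutral_left) (auto simp: g_def)
    also have "\<dots> * (real Q)\<^sup>2 \<le> e * (real Q)\<^sup>2"
      using z[of "Suc z" "Suc Q"] by (intro mult_right_mono) auto
    finally have tail: "(\<Sum>p\<in>?I. real (card (sieved_pairs P {} p Q))) \<le> e * (real Q)\<^sup>2" .
    have "(beta_const P / 2 - e) * (real Q)\<^sup>2 \<le> ?W Q"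
      using elim by (simp add: pos_less_divide_eq)
    also have "?W Q \<le> real (farey_card P Q) + (\<Sum>p\<in>?I. real (card (sieved_pairs P {} p Q)))"
      using sieved_pairs_le_farey_card[OF assms(1), of z Q]
      by (metis (no_types, lifting) of_nat_add of_nat_le_iff of_nat_sum sum.cong)
    finally have "(beta_const P / 2 - e) * (real Q)\<^sup>2 - e * (real Q)\<^sup>2 \<le> real (farey_card P Q)"
      using tail by linarith
    moreover have "(beta_const P / 2 - e) * (real Q)\<^sup>2 - e * (real Q)\<^sup>2 = b * (real Q)\<^sup>2"
      unfolding left_diff_distrib[symmetric] by (simp add: e_def)
    ultimately show ?case by simp
  qed
qed

section \<open>Counting close pairs by their denominators and the gcd of these\<close>

lemma card_fraction_difference_le_gcd:
  fixes q r :: nat and k :: int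
  assumes "q > 0" "r > 0"
  shows "card {(a, b). a \<in> {1..q} \<and> b \<in> {1..r} \<and>
    (\<exists>j::int. int a * int r - int b * int q - j * int q * int r = k)} \<le> gcd q r"
    (is "card ?F \<le> _")
proof -
  define g where "g = gcd q r"
  define s where "s = q div g"
  define t where "t = r div g"
  have g: "g > 0" using assms by (simp add: g_def)
  have q: "q = g * s" and r: "r = g * t" by (auto simp: s_def t_def g_def)
  have st: "coprime s t" using assms unfolding s_def t_def g_def by (intro div_gcd_coprime) auto
  have pos: "s > 0" "t > 0" using assms q r by (auto intro!: Nat.gr0I)
  \<comment> \<open>Two solutions satisfy \<open>s dvd (a - c) * t\<close> with \<open>s\<close> and
    \<open>t\<close> coprime, so \<open>k\<close> fixes \<open>a\<close> modulo \<open>s\<close>.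
    The index of the block of length \<open>s\<close> that contains \<open>a\<close> then fixes
    \<open>a\<close>, and with it \<open>b\<close> modulo \<open>r\<close>, hence \<open>b\<close>.
    The shift to \<open>a - 1\<close> is there because \<open>a\<close> starts at 1; it leaves
    exactly \<open>g\<close> blocks.\<close>
  have "inj_on (\<lambda>(a, b). (a - 1) div s) ?F"
  proof (rule inj_onI)
    fix x y assume xF: "x \<in> ?F" and yF: "y \<in> ?F"
      and xy: "(case x of (a, b) \<Rightarrow> (a - 1) div s) = (case y of (a, b) \<Rightarrow> (a - 1) div s)"
    obtain a b where x: "x = (a, b)" by fastforce
    obtain c d where y: "y = (c, d)" by fastforce
    obtain i j :: int where ij: "int a * int r - int b * int q - i * int q * int r = k"
        "int c * int r - int d * int q - j * int q * int r = k"
      using xF yF unfolding x y by auto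
    have ran: "1 \<le> a" "a \<le> q" "1 \<le> b" "b \<le> r" "1 \<le> c" "c \<le> q" "1 \<le> d" "d \<le> r"
      using xF yF unfolding x y by auto
    have eq: "(int a - int c) * int r = int q * ((int b - int d) + (i - j) * int r)"
      using ij by (simp add: algebra_simps)
    then have "int g * ((int a - int c) * int t) = int g * (int s * ((int b - int d) + (i - j) * int r))"
      unfolding q r by (simp add: algebra_simps)
    then have "(int a - int c) * int t = int s * ((int b - int d) + (i - j) * int r)"
      using g by simp
    then have "int s dvd (int a - int c) * int t" by simp
    then have sd: "int s dvd int a - int c"
      using st by (simp add: coprime_dvd_mult_left_iff)
    have "(a - 1) mod s = (c - 1) mod s"
    proof -
      have "int s dvd int (a - 1) - int (c - 1)" using sd ran by (simp add: of_nat_diff)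
      then have "int (a - 1) mod int s = int (c - 1) mod int s" by (simp add: mod_eq_dvd_iff)
      then show ?thesis by (metis of_nat_eq_iff zmod_int)
    qed
    moreover have "(a - 1) div s = (c - 1) div s" using xy unfolding x y by simp
    ultimately have "a - 1 = c - 1" by (metis div_mod_decomp)
    then have ac: "a = c" using ran by simp
    then have "(int b - int d) + (i - j) * int r = 0" using eq assms by simp
    then have "int b - int d = int r * (j - i)" by (simp add: algebra_simps)
    then have "int r dvd int b - int d" by simp
    then have "int b - int d = 0"
      using dvd_imp_le_int[of "int b - int d" "int r"] ran by fastforce
    then show "x = y" using ac x y by simp
  qed
  moreover have "(\<lambda>(a, b). (a - 1) div s) ` ?F \<subseteq> {..<g}"
    using pos by (auto simp: q div_less_iff_less_mult)
  ultimately have "card ?F \<le> card {..<g}" by (intro card_inj_on_le) auto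
  then show ?thesis by (simp add: g_def)
qed

text \<open>A half-open interval contains at most its length plus one integers, here for the
  quotients \<open>q / g\<close>. The maximum with 0 covers \<open>x > Q\<close>, where the set is
  empty.\<close>

lemma card_multiples_between_le:
  fixes x :: real
  assumes "g > 0" "x \<ge> 0"
  shows "real (card {q \<in> {1..Q}. x < real q \<and> g dvd q}) \<le> max 0 (real Q - x) / real g + 1"
proof -
  define n where "n = nat \<lfloor>x / real g\<rfloor>"
  have "real n = of_int \<lfloor>x / real g\<rfloor>" using assms by (simp add: n_def)
  then have n: "real n \<le> x / real g" "x / real g < real n + 1" by linarith+
  have "{q \<in> {1..Q}. x < real q \<and> g dvd q} \<subseteq> (\<lambda>j. g * j) ` {n<..Q div g}"
  proof
    fix q assume q: "q \<in> {q \<in> {1..Q}. x < real q \<and> g dvd q}"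
    then obtain j where j: "q = g * j" by auto
    have "x < real g * real j" using q j by simp
    then have "x / real g < real j" using assms by (simp add: divide_less_eq mult.commute)
    then have "n < j" using n by linarith
    moreover have "j \<le> Q div g" using q j assms by (simp add: less_eq_div_iff_mult_less_eq mult.commute)
    ultimately show "q \<in> (\<lambda>j. g * j) ` {n<..Q div g}" using j by auto
  qed
  then have "card {q \<in> {1..Q}. x < real q \<and> g dvd q} \<le> card ((\<lambda>j. g * j) ` {n<..Q div g})"
    by (intro card_mono) auto
  also have "\<dots> \<le> card {n<..Q div g}" by (rule card_image_le) simp
  finally have le: "card {q \<in> {1..Q}. x < real q \<and> g dvd q} \<le> Q div g - n" by simp
  show ?thesis
  proof (cases "n \<le> Q div g")
    case True
    have "real (card {q \<in> {1..Q}. x < real q \<and> g dvd q}) \<le> real (Q div g) - real n"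
      using le True by (simp add: of_nat_diff[symmetric] del: of_nat_diff)
    also have "\<dots> \<le> real Q / real g - (x / real g - 1)"
      using n of_nat_div_le_of_nat[of Q g, where 'a = real] by linarith
    also have "\<dots> = (real Q - x) / real g + 1" by (simp add: diff_divide_distrib)
    also have "\<dots> \<le> max 0 (real Q - x) / real g + 1" by (intro add_right_mono divide_right_mono) auto
    finally show ?thesis .
  next
    case False
    then have *: "card {q \<in> {1..Q}. x < real q \<and> g dvd q} = 0" using le by linarith
    show ?thesis unfolding * by simp
  qed
qed

text \<open>Works with numerators and denominators instead of rational numbers, and admits every
  representation. This only enlarges the count, which is to be bounded from above. The integer
  \<open>j\<close> expresses distance modulo 1.\<close>

definition close_pairs :: "nat \<Rightarrow> real \<Rightarrow> ((nat \<times> nat) \<times> (nat \<times> nat)) set" where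
  "close_pairs Q w = {((a, q), (b, r)). 1 \<le> a \<and> a \<le> q \<and> q \<le> Q \<and> 1 \<le> b \<and> b \<le> r \<and> r \<le> Q \<and>
     (\<exists>j::int. 0 < real a / real q - real b / real r - of_int j \<and>
        real a / real q - real b / real r - of_int j < w)}"

lemma finite_close_pairs: "finite (close_pairs Q w)"
  by (rule finite_subset[of _ "({1..Q} \<times> {1..Q}) \<times> ({1..Q} \<times> {1..Q})"])
    (auto simp: close_pairs_def)

text \<open>The pairs are covered by classes indexed by \<open>k\<close>, the difference times
  \<open>q * r\<close>, and by \<open>g = gcd q r\<close>. Each squared bracket bounds the choices
  of \<open>(q, r)\<close>, each factor \<open>g\<close> the choices of numerators.\<close>

lemma card_close_pairs_le:
  assumes "T > 0" "T \<le> real K" "Q > 0"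
  shows "real (card (close_pairs Q (T / (real Q)\<^sup>2))) \<le>
    (\<Sum>k=1..K. \<Sum>g | g dvd k. real g * (max 0 (1 - real k / T) * real Q / real g + 1)\<^sup>2)"
proof -
  \<comment> \<open>\<open>A\<close> collects the denominators allowed by \<open>k\<close> and
    \<open>g\<close>, \<open>B\<close> the pairs of them with gcd exactly \<open>g\<close>,
    \<open>F\<close> the numerators over fixed denominators, and \<open>Z\<close> the resulting
    quadruples.\<close>
  define A where "A = (\<lambda>k g. {q \<in> {1..Q}. real k * real Q / T < real q \<and> g dvd q})"
  define B where "B = (\<lambda>k g. {x \<in> A k g \<times> A k g. gcd (fst x) (snd x) = g})"
  define F where "F = (\<lambda>(k::nat) q r. {(a, b). a \<in> {1..q} \<and> b \<in> {1..r} \<and>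
    (\<exists>j::int. int a * int r - int b * int q - j * int q * int r = int k)})"
  define Z where "Z = (\<lambda>k x. (\<lambda>(a, b). ((a, fst x), (b, snd x))) ` F k (fst x) (snd x))"
  have finA: "finite (A k g)" for k g unfolding A_def by auto
  have finB: "finite (B k g)" for k g
    unfolding B_def by (rule finite_subset[of _ "A k g \<times> A k g"]) (auto simp: finA)
  have finF: "finite (F k q r)" for k q r
    unfolding F_def by (rule finite_subset[of _ "{1..q} \<times> {1..r}"]) auto
  have finZ: "finite (Z k x)" for k x unfolding Z_def by (intro finite_imageI finF)
  have sub: "close_pairs Q (T / (real Q)\<^sup>2) \<subseteq> (\<Union>k\<in>{1..K}. \<Union>g\<in>{g. g dvd k}. \<Union>x\<in>B k g. Z k x)"
  proof
    fix y assume y: "y \<in> close_pairs Q (T / (real Q)\<^sup>2)"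
    obtain a q b r where yy: "y = ((a, q), (b, r))" by (metis prod.exhaust)
    obtain j :: int where h: "1 \<le> a" "a \<le> q" "q \<le> Q" "1 \<le> b" "b \<le> r" "r \<le> Q"
      and j: "0 < real a / real q - real b / real r - of_int j"
        "real a / real q - real b / real r - of_int j < T / (real Q)\<^sup>2"
      using y unfolding yy close_pairs_def by auto
    define d where "d = real a / real q - real b / real r - of_int j"
    define k where "k = int a * int r - int b * int q - j * int q * int r"
    have q0: "real q > 0" and r0: "real r > 0" using h by auto
    have kd: "real_of_int k = d * (real q * real r)"
      unfolding k_def d_def using q0 r0 by (simp add: field_simps)
    then have "real_of_int k > 0" using j q0 r0 by (simp add: d_def)
    then have k0: "k > 0" by simp
    define n where "n = nat k"
    have n: "int n = k" "n \<ge> 1" using k0 by (auto simp: n_def)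
    have nr: "real n = real_of_int k" using n by (metis of_int_of_nat_eq)
    have lt: "real n < T / (real Q)\<^sup>2 * (real q * real r)"
      unfolding nr kd using j q0 r0 by (intro mult_strict_right_mono) (auto simp: d_def)
    have Q0: "real Q > 0" using assms by simp
    \<comment> \<open>Replacing one denominator by its bound \<open>Q\<close> gives a lower bound
      for the other, of size \<open>n * Q / T\<close>; together with \<open>q \<le> Q\<close> it
      also gives \<open>n < T\<close>.\<close>
    have "T / (real Q)\<^sup>2 * (real q * real r) \<le> T / (real Q)\<^sup>2 * (real q * real Q)"
      using h assms by (intro mult_left_mono) auto
    also have "\<dots> = T * real q / real Q" using Q0 by (simp add: power2_eq_square)
    finally have lq: "real n < T * real q / real Q" using lt by linarith
    have "T / (real Q)\<^sup>2 * (real q * real r) \<le> T / (real Q)\<^sup>2 * (real Q * real r)"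
      using h assms by (intro mult_left_mono mult_right_mono) auto
    also have "\<dots> = T * real r / real Q" using Q0 by (simp add: power2_eq_square)
    finally have lr: "real n < T * real r / real Q" using lt by linarith
    have "T * real q / real Q \<le> T" using h assms by (simp add: divide_le_eq mult_left_mono)
    then have nK: "n \<le> K" using lq assms by linarith
    have "real n * real Q / T < real q" "real n * real Q / T < real r"
      using lq lr Q0 assms by (simp_all add: field_simps)
    then have "(q, r) \<in> B n (gcd q r)" using h by (auto simp: B_def A_def)
    moreover have "gcd q r dvd n"
    proof -
      have "int (gcd q r) dvd k" unfolding k_def
        by (intro dvd_diff dvd_mult dvd_mult2) auto
      then show ?thesis using n by (metis int_dvd_int_iff)
    qed
    moreover have "y \<in> Z n (q, r)"
      unfolding Z_def F_def yy using h n by (auto simp: k_def image_iff)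
    ultimately show "y \<in> (\<Union>k\<in>{1..K}. \<Union>g\<in>{g. g dvd k}. \<Union>x\<in>B k g. Z k x)"
      using n nK by (intro UN_I[of n] UN_I[of "gcd q r"] UN_I[of "(q, r)"]) simp_all
  qed
  have cZ: "card (Z k x) \<le> g" if "x \<in> B k g" for k g x
  proof -
    have "fst x > 0" "snd x > 0" "gcd (fst x) (snd x) = g" using that by (auto simp: B_def A_def)
    moreover have "card (Z k x) \<le> card (F k (fst x) (snd x))"
      unfolding Z_def by (intro card_image_le finF)
    ultimately show ?thesis
      using card_fraction_difference_le_gcd[of "fst x" "snd x" "int k"] unfolding F_def by simp
  qed
  have cA: "real (card (A k g)) \<le> max 0 (1 - real k / T) * real Q / real g + 1" if "g > 0" for k g
  proof -
    have "real (card (A k g)) \<le> max 0 (real Q - real k * real Q / T) / real g + 1"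
      unfolding A_def using that assms by (intro card_multiples_between_le) auto
    also have "real Q - real k * real Q / T = (1 - real k / T) * real Q" by (simp add: algebra_simps)
    also have "max 0 \<dots> = max 0 (1 - real k / T) * real Q"
      by (auto simp: max_def zero_le_mult_iff mult_le_0_iff)
    finally show ?thesis .
  qed
  have inner: "real (card (\<Union>x\<in>B k g. Z k x)) \<le> real g * (max 0 (1 - real k / T) * real Q / real g + 1)\<^sup>2"
    if "g > 0" for k g
  proof -
    have "card (\<Union>x\<in>B k g. Z k x) \<le> (\<Sum>x\<in>B k g. card (Z k x))" by (rule card_UN_le[OF finB])
    also have "\<dots> \<le> (\<Sum>x\<in>B k g. g)" by (intro sum_mono cZ)
    also have "\<dots> = card (B k g) * g" by simp
    \<comment> \<open>The exact gcd is relaxed here: only divisibility of both denominators by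
      \<open>g\<close> is kept.\<close>
    also have "card (B k g) \<le> card (A k g \<times> A k g)"
      unfolding B_def by (intro card_mono) (auto simp: finA)
    also have "\<dots> = (card (A k g))\<^sup>2" by (simp add: card_cartesian_product power2_eq_square)
    finally have "card (\<Union>x\<in>B k g. Z k x) \<le> g * (card (A k g))\<^sup>2" by (simp add: mult.commute)
    then have "real (card (\<Union>x\<in>B k g. Z k x)) \<le> real g * (real (card (A k g)))\<^sup>2"
      by (metis of_nat_le_iff of_nat_mult of_nat_power)
    also have "\<dots> \<le> real g * (max 0 (1 - real k / T) * real Q / real g + 1)\<^sup>2"
      using cA[OF that] by (intro mult_left_mono power_mono) auto
    finally show ?thesis .
  qed
  have finD: "finite {g. g dvd k}" if "k \<in> {1..K}" for k using that by (intro finite_divisors_nat) auto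
  have "card (close_pairs Q (T / (real Q)\<^sup>2)) \<le> card (\<Union>k\<in>{1..K}. \<Union>g\<in>{g. g dvd k}. \<Union>x\<in>B k g. Z k x)"
    using sub by (intro card_mono finite_UN_I finD finB finZ finite_atLeastAtMost)
  also have "\<dots> \<le> (\<Sum>k=1..K. card (\<Union>g\<in>{g. g dvd k}. \<Union>x\<in>B k g. Z k x))"
    by (rule card_UN_le) simp
  also have "\<dots> \<le> (\<Sum>k=1..K. \<Sum>g | g dvd k. card (\<Union>x\<in>B k g. Z k x))"
    by (intro sum_mono card_UN_le finD)
  finally have "real (card (close_pairs Q (T / (real Q)\<^sup>2))) \<le>
      (\<Sum>k=1..K. \<Sum>g | g dvd k. real (card (\<Union>x\<in>B k g. Z k x)))"
    by (metis (mono_tags, lifting) of_nat_le_iff of_nat_sum sum.cong)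
  also have "\<dots> \<le> (\<Sum>k=1..K. \<Sum>g | g dvd k. real g * (max 0 (1 - real k / T) * real Q / real g + 1)\<^sup>2)"
    by (intro sum_mono inner) (auto intro!: Nat.gr0I)
  finally show ?thesis .
qed

text \<open>The lower bound on the number of fractions enters twice: it widens the window to
  \<open>T / Q^2\<close> with \<open>T = \<Lambda> / b\<close>, and it bounds the normalising
  factor. Division by \<open>Q^2\<close> turns the rounding error 1 into \<open>1 / Q\<close>, and
  the range of summation does not depend on \<open>Q\<close>.\<close>

lemma pair_correlation_le:
  assumes "b > 0" "Q > 0" "b * (real Q)\<^sup>2 \<le> real (farey_card P Q)" "\<Lambda> > 0" "\<Lambda> / b \<le> real K"
  shows "pair_correlation P Q \<Lambda> \<le>
    1 / b * (\<Sum>k=1..K. \<Sum>g | g dvd k. real g * (max 0 (1 - real k * b / \<Lambda>) / real g + 1 / real Q)\<^sup>2)"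
proof -
  define N where "N = real (farey_card P Q)"
  define T where "T = \<Lambda> / b"
  let ?X = "{(\<gamma>\<^sub>1, \<gamma>\<^sub>2). \<gamma>\<^sub>1 \<in> farey_set P Q \<and> \<gamma>\<^sub>2 \<in> farey_set P Q \<and> \<gamma>\<^sub>1 \<noteq> \<gamma>\<^sub>2 \<and>
       (\<exists>t\<in>{0<..<\<Lambda>}. \<exists>k::int. \<gamma>\<^sub>1 - \<gamma>\<^sub>2 = 1 / N * t + of_int k)}"
  let ?Y = "close_pairs Q (T / (real Q)\<^sup>2)"
  let ?S = "\<lambda>u. \<Sum>k=1..K. \<Sum>g | g dvd k. real g * (u k g)\<^sup>2"
  have bQ: "b * (real Q)\<^sup>2 > 0" using assms by simp
  have N: "N > 0" "b * (real Q)\<^sup>2 \<le> N" using assms(3) bQ unfolding N_def by linarith+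
  have "?X \<subseteq> (\<lambda>((a, q), (b, r)). (real a / real q, real b / real r)) ` ?Y"
  proof
    fix z assume z: "z \<in> ?X"
    obtain x y where zxy: "z = (x, y)" by fastforce
    obtain t k where t: "0 < t" "t < \<Lambda>" "x - y = 1 / N * t + of_int (k::int)"
      using z unfolding zxy by auto
    obtain a q c r where aq: "x = real a / real q" "1 \<le> a" "a \<le> q" "q \<le> Q"
      and cr: "y = real c / real r" "1 \<le> c" "c \<le> r" "r \<le> Q"
      using z unfolding zxy farey_set_def by auto
    have eq: "x - y - of_int k = t / N" using t by simp
    have "t / N > 0" using t N by simp
    moreover have "t / N < T / (real Q)\<^sup>2"
    proof -
      have "t / N < \<Lambda> / N" using t N by (intro divide_strict_right_mono) auto
      also have "\<dots> \<le> \<Lambda> / (b * (real Q)\<^sup>2)" using assms(4) by (intro divide_left_mono mult_pos_pos N bQ) simp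
      finally show ?thesis by (simp add: T_def)
    qed
    ultimately have "\<exists>j::int. 0 < real a / real q - real c / real r - of_int j \<and>
        real a / real q - real c / real r - of_int j < T / (real Q)\<^sup>2"
      using eq unfolding aq(1) cr(1) by (intro exI[of _ k]) simp
    then have "((a, q), (c, r)) \<in> ?Y"
      using aq cr unfolding close_pairs_def by simp
    then show "z \<in> (\<lambda>((a, q), (b, r)). (real a / real q, real b / real r)) ` ?Y"
      using aq cr zxy by force
  qed
  then have "card ?X \<le> card ((\<lambda>((a, q), (b, r)). (real a / real q, real b / real r)) ` ?Y)"
    by (intro card_mono finite_imageI finite_close_pairs)
  also have "\<dots> \<le> card ?Y" by (intro card_image_le finite_close_pairs)
  finally have XY: "real (card ?X) \<le> real (card ?Y)" by simp
  have "pair_correlation P Q \<Lambda> = 1 / N * real (card ?X)"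
    unfolding pair_correlation_def N_def by simp
  also have "\<dots> \<le> 1 / (b * (real Q)\<^sup>2) * real (card ?Y)"
  proof (rule mult_mono[OF _ XY])
    show "1 / N \<le> 1 / (b * (real Q)\<^sup>2)" by (intro divide_left_mono mult_pos_pos N bQ) simp
  qed (use bQ in \<open>simp_all add: less_imp_le\<close>)
  also have "\<dots> \<le> 1 / (b * (real Q)\<^sup>2) * ?S (\<lambda>k g. max 0 (1 - real k / T) * real Q / real g + 1)"
    using assms bQ by (intro mult_left_mono card_close_pairs_le) (auto simp: T_def)
  also have "\<dots> = 1 / b * ?S (\<lambda>k g. max 0 (1 - real k * b / \<Lambda>) / real g + 1 / real Q)"
  proof -
    have "real g * (max 0 (1 - real k / T) * real Q / real g + 1)\<^sup>2 =
        (real Q)\<^sup>2 * (real g * (max 0 (1 - real k * b / \<Lambda>) / real g + 1 / real Q)\<^sup>2)" for k g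
    proof -
      have "max 0 (1 - real k / T) * real Q / real g + 1 =
          real Q * (max 0 (1 - real k * b / \<Lambda>) / real g + 1 / real Q)"
        using assms by (simp add: T_def distrib_left)
      then show ?thesis by (simp add: power_mult_distrib)
    qed
    then have "?S (\<lambda>k g. max 0 (1 - real k / T) * real Q / real g + 1) =
        (real Q)\<^sup>2 * ?S (\<lambda>k g. max 0 (1 - real k * b / \<Lambda>) / real g + 1 / real Q)"
      by (simp only: sum_distrib_left)
    then show ?thesis using assms by simp
  qed
  finally show ?thesis .
qed

section \<open>Evaluation of the integral and comparison term by term\<close>

lemma half_square_le_log_area:
  fixes y :: real
  assumes "0 < y" "y \<le> 1"
  shows "(1 - y)\<^sup>2 / 2 \<le> 1 - y + y * ln y"
proof -
  let ?f = "\<lambda>y::real. 1 - y + y * ln y - (1 - y)\<^sup>2 / 2"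
  \<comment> \<open>The difference vanishes at 1 and has derivative
    \<open>ln x + 1 - x \<le> 0\<close>.\<close>
  have "?f 1 \<le> ?f y"
  proof (rule DERIV_nonpos_imp_nonincreasing[OF assms(2)])
    fix x assume x: "y \<le> x" "x \<le> 1"
    then have "x > 0" using assms by simp
    then have "(?f has_real_derivative ln x + (1 - x)) (at x)"
      by (auto intro!: derivative_eq_intros simp: field_simps)
    moreover have "ln x + (1 - x) \<le> 0" using ln_le_minus_one[OF \<open>x > 0\<close>] by simp
    ultimately show "\<exists>d. (?f has_real_derivative d) (at x) \<and> d \<le> 0" by blast
  qed
  then show ?thesis by simp
qed

text \<open>The contribution of a single \<open>m\<close> to the integral, with
  \<open>c = m * \<beta> / 2\<close>. The cut-off sits in the integrand so that all \<open>m\<close>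
  share the range of integration.\<close>

lemma has_integral_log_kernel:
  fixes c \<Lambda> :: real
  assumes "c > 0" "\<Lambda> > 0"
  shows "((\<lambda>t. if c < t then ln (t / c) / t\<^sup>2 else 0) has_integral
           (if c < \<Lambda> then (1 - c / \<Lambda> + c / \<Lambda> * ln (c / \<Lambda>)) / c else 0)) {0..\<Lambda>}"
proof (cases "c < \<Lambda>")
  case True
  \<comment> \<open>An antiderivative is \<open>- (1 + ln (t / c)) / t\<close>.\<close>
  have "((\<lambda>t. ln (t / c) / t\<^sup>2) has_integral
      (- (1 + ln (\<Lambda> / c)) / \<Lambda> - (- (1 + ln (c / c)) / c))) {c..\<Lambda>}"
  proof (rule fundamental_theorem_of_calculus)
    fix t assume t: "t \<in> {c..\<Lambda>}"
    then have "t > 0" using assms by simp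
    then have "((\<lambda>t. - (1 + ln (t / c)) / t) has_real_derivative ln (t / c) / t\<^sup>2) (at t)"
      using assms by (auto intro!: derivative_eq_intros simp: field_simps power2_eq_square)
    then show "((\<lambda>t. - (1 + ln (t / c)) / t) has_vector_derivative ln (t / c) / t\<^sup>2) (at t within {c..\<Lambda>})"
      using has_real_derivative_iff_has_vector_derivative has_vector_derivative_at_within by blast
  qed (use True in simp)
  \<comment> \<open>At the endpoint \<open>t = c\<close> the two integrands agree because
    \<open>ln 1 = 0\<close>.\<close>
  then have "((\<lambda>t. if c < t then ln (t / c) / t\<^sup>2 else 0) has_integral
      (- (1 + ln (\<Lambda> / c)) / \<Lambda> - (- (1 + ln (c / c)) / c))) {c..\<Lambda>}"
    by (rule has_integral_eq[rotated]) (use assms in auto)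
  moreover have "((\<lambda>t. if c < t then ln (t / c) / t\<^sup>2 else 0) has_integral 0) {0..c}"
    by (rule has_integral_is_0) auto
  ultimately have "((\<lambda>t. if c < t then ln (t / c) / t\<^sup>2 else 0) has_integral
      (0 + (- (1 + ln (\<Lambda> / c)) / \<Lambda> - (- (1 + ln (c / c)) / c)))) {0..\<Lambda>}"
    using True assms by (intro has_integral_combine) auto
  moreover have "0 + (- (1 + ln (\<Lambda> / c)) / \<Lambda> - (- (1 + ln (c / c)) / c)) =
      (1 - c / \<Lambda> + c / \<Lambda> * ln (c / \<Lambda>)) / c"
    using assms by (simp add: ln_div field_simps)
  ultimately show ?thesis using True by simp
next
  case False
  have "((\<lambda>t. if c < t then ln (t / c) / t\<^sup>2 else 0) has_integral 0) {0..\<Lambda>}"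
    by (rule has_integral_is_0) (use False in auto)
  then show ?thesis using False by simp
qed

text \<open>These are the terms of \<open>h_weight\<close> with both \<open>d\<close> equal to 1,
  \<open>\<delta> = g\<close> and \<open>n = m div g\<close>; there \<open>root_count\<close> is 1,
  and the remaining terms are nonnegative.\<close>

lemma h_weight_ge_sum_divisors:
  assumes "m > 0"
  shows "(\<Sum>g | g dvd m. real m / real g) \<le> real (h_weight P m)"
proof -
  let ?H = "{(n, \<delta>, d\<^sub>1, d\<^sub>2). n \<ge> 1 \<and> \<delta> \<ge> 1 \<and> d\<^sub>1 \<ge> 1 \<and> d\<^sub>2 \<ge> (1::nat) \<and> n * \<delta> * d\<^sub>1 * d\<^sub>2 = m}"
  let ?w = "\<lambda>(n, \<delta>, d\<^sub>1, d\<^sub>2). n * root_count P d\<^sub>1 * root_count P d\<^sub>2"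
  let ?i = "\<lambda>g. (m div g, g, 1::nat, 1::nat)"
  have "?H \<subseteq> {..m} \<times> {..m} \<times> {..m} \<times> {..m}"
  proof
    fix x assume "x \<in> ?H"
    moreover obtain n \<delta> d\<^sub>1 d\<^sub>2 where x: "x = (n, \<delta>, d\<^sub>1, d\<^sub>2)" by (cases x)
    ultimately have "m = n * \<delta> * d\<^sub>1 * d\<^sub>2" by simp
    then have "n dvd m" "\<delta> dvd m" "d\<^sub>1 dvd m" "d\<^sub>2 dvd m" by simp_all
    then show "x \<in> {..m} \<times> {..m} \<times> {..m} \<times> {..m}"
      using assms unfolding x by (simp add: dvd_imp_le)
  qed
  then have finH: "finite ?H" by (rule finite_subset) auto
  have gpos: "g > 0" if "g dvd m" for g using that assms by (auto intro!: Nat.gr0I)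
  have "(\<Sum>g | g dvd m. real m / real g) = (\<Sum>g | g dvd m. real (m div g))"
    by (rule sum.cong) (auto simp: real_of_nat_div)
  then have eq: "(\<Sum>g | g dvd m. real m / real g) = real (\<Sum>g | g dvd m. ?w (?i g))" by simp
  have "(\<Sum>g | g dvd m. ?w (?i g)) = sum ?w (?i ` {g. g dvd m})"
    by (rule sum.reindex[symmetric, unfolded o_def]) (auto intro!: inj_onI)
  also have "\<dots> \<le> sum ?w ?H"
  proof (rule sum_mono2[OF finH])
    show "?i ` {g. g dvd m} \<subseteq> ?H"
    proof
      fix x assume "x \<in> ?i ` {g. g dvd m}"
      then obtain g where g: "x = ?i g" "g dvd m" by blast
      then have "m div g * g = m" by simp
      moreover have "m div g \<ge> 1"
        using dvd_imp_le[OF g(2) assms] gpos[OF g(2)] by (simp add: Suc_le_eq div_greater_zero_iff)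
      ultimately show "x \<in> ?H" using gpos[OF g(2)] g(1) by simp
    qed
  qed simp
  finally show ?thesis unfolding h_weight_def eq by (rule of_nat_mono)
qed

text \<open>The comparison is made separately for each \<open>m\<close>. The number
  \<open>c m\<close> is the threshold that \<open>t\<close> must pass for \<open>m\<close> to enter
  the sum, and \<open>J m\<close> is the integral of its kernel. Since \<open>K\<close> bounds all
  \<open>m\<close> that occur, the sum becomes one over a fixed range.\<close>

lemma pair_density_integral_ge:
  assumes "\<beta> > 0" "\<Lambda> > 0" "2 * \<Lambda> / \<beta> \<le> real K"
  shows "1 / (\<beta> / 2) * (\<Sum>k=1..K. \<Sum>g | g dvd k. real g * (max 0 (1 - real k * (\<beta> / 2) / \<Lambda>) / real g)\<^sup>2)
    \<le> 2 * integral {0..\<Lambda>} (\<lambda>t. 1 / t\<^sup>2 * (\<Sum>m | 1 \<le> m \<and> real m < 2 * t / \<beta>.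
                 real (h_weight P m) * ln (2 * t / (real m * \<beta>))))"
proof -
  define c where "c = (\<lambda>m::nat. real m * \<beta> / 2)"
  define J where "J = (\<lambda>m. if c m < \<Lambda> then (1 - c m / \<Lambda> + c m / \<Lambda> * ln (c m / \<Lambda>)) / c m else 0)"
  let ?f = "\<lambda>t. 1 / t\<^sup>2 * (\<Sum>m | 1 \<le> m \<and> real m < 2 * t / \<beta>. real (h_weight P m) * ln (2 * t / (real m * \<beta>)))"
  let ?g = "\<lambda>t. \<Sum>m=1..K. real (h_weight P m) * (if c m < t then ln (t / c m) / t\<^sup>2 else 0)"
  have c0: "c m > 0" if "m \<in> {1..K}" for m using that assms by (simp add: c_def)
  have eq: "?f t = ?g t" if "t \<in> {0..\<Lambda>}" for t
  proof -
    have lt: "real m < 2 * t / \<beta> \<longleftrightarrow> c m < t" for m using assms by (simp add: c_def field_simps)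
    have "2 * t / \<beta> \<le> 2 * \<Lambda> / \<beta>" using that assms by (intro divide_right_mono) auto
    then have tK: "2 * t / \<beta> \<le> real K" using assms by linarith
    have mK: "m \<le> K" if "c m < t" for m
      using that lt[of m] tK by linarith
    have "?f t = (\<Sum>m | 1 \<le> m \<and> real m < 2 * t / \<beta>. real (h_weight P m) * (ln (t / c m) / t\<^sup>2))"
      unfolding sum_distrib_left by (rule sum.cong) (auto simp: c_def mult.commute)
    also have "\<dots> = ?g t"
      by (rule sum.mono_neutral_cong_left) (use mK lt in auto)
    finally show ?thesis .
  qed
  have "(?g has_integral (\<Sum>m=1..K. real (h_weight P m) * J m)) {0..\<Lambda>}"
    unfolding J_def
    by (intro has_integral_sum has_integral_mult_right has_integral_log_kernel c0 assms) auto
  then have "(?f has_integral (\<Sum>m=1..K. real (h_weight P m) * J m)) {0..\<Lambda>}"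
    by (rule has_integral_eq[rotated]) (use eq in simp)
  then have int: "integral {0..\<Lambda>} ?f = (\<Sum>m=1..K. real (h_weight P m) * J m)"
    by (rule integral_unique)
  have J: "(max 0 (1 - c m / \<Lambda>))\<^sup>2 / (2 * c m) \<le> J m" if m: "m \<in> {1..K}" for m
  proof (cases "c m < \<Lambda>")
    case True
    have "(1 - c m / \<Lambda>)\<^sup>2 / 2 / c m \<le> (1 - c m / \<Lambda> + c m / \<Lambda> * ln (c m / \<Lambda>)) / c m"
      using c0[OF m] True assms by (intro divide_right_mono half_square_le_log_area) auto
    moreover have "max 0 (1 - c m / \<Lambda>) = 1 - c m / \<Lambda>" using True assms by simp
    ultimately show ?thesis using True by (simp add: J_def)
  next
    case False
    then have "max 0 (1 - c m / \<Lambda>) = 0" using assms by (simp add: max_def)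
    then show ?thesis using False by (simp add: J_def)
  qed
  have "1 / (\<beta> / 2) * (\<Sum>g | g dvd m. real g * (max 0 (1 - real m * (\<beta> / 2) / \<Lambda>) / real g)\<^sup>2)
      \<le> 2 * (real (h_weight P m) * J m)" if m: "m \<in> {1..K}" for m
  proof -
    let ?M = "max 0 (1 - c m / \<Lambda>)"
    have m0: "m > 0" using m by simp
    have "1 / (\<beta> / 2) * (\<Sum>g | g dvd m. real g * (max 0 (1 - real m * (\<beta> / 2) / \<Lambda>) / real g)\<^sup>2)
        = (\<Sum>g | g dvd m. 2 * (real m / real g * (?M\<^sup>2 / (2 * c m))))"
      unfolding sum_distrib_left
    proof (rule sum.cong)
      fix g assume "g \<in> {g. g dvd m}"
      then have "g > 0" using m0 by (auto intro!: Nat.gr0I)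
      moreover have "max 0 (1 - real m * (\<beta> / 2) / \<Lambda>) = ?M" by (simp add: c_def)
      ultimately show "1 / (\<beta> / 2) * (real g * (max 0 (1 - real m * (\<beta> / 2) / \<Lambda>) / real g)\<^sup>2) =
          2 * (real m / real g * (?M\<^sup>2 / (2 * c m)))"
        using m0 assms unfolding \<open>_ = ?M\<close> by (simp add: c_def power_divide power2_eq_square)
    qed simp
    also have "\<dots> = 2 * ((\<Sum>g | g dvd m. real m / real g) * (?M\<^sup>2 / (2 * c m)))"
      by (simp only: sum_distrib_left sum_distrib_right)
    also have "\<dots> \<le> 2 * (real (h_weight P m) * J m)"
      using h_weight_ge_sum_divisors[OF m0, of P] J[OF m] c0[OF m]
      by (intro mult_left_mono mult_mono) auto
    finally show ?thesis .
  qed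
  then show ?thesis
    unfolding int sum_distrib_left[of _ _ "{1..K}"] by (intro sum_mono)
qed

section \<open>Passage to the limit, first in \<open>Q\<close> and then in \<open>b\<close>\<close>

theorem theorem1p3:
  shows "\<exists>C::real. C > 0 \<and>
    (\<forall>(\<nu>::nat) (P::int poly).
       \<nu> \<ge> 2 \<and> degree P = \<nu> \<and> coeff P 0 = 0 \<and> discriminant P \<noteq> 0 \<longrightarrow>
       (\<forall>\<Lambda>::real. \<Lambda> > 0 \<longrightarrow>
          \<bar>limsup (\<lambda>Q. ereal (pair_correlation P Q \<Lambda>))\<bar> \<noteq> \<infinity> \<and>
          limsup (\<lambda>Q. ereal (pair_correlation P Q \<Lambda>)) \<le>
            ereal (C * integral {0..\<Lambda>} (\<lambda>t. 1 / t\<^sup>2 *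
              (\<Sum>m | 1 \<le> m \<and> real m < 2 * t / beta_const P.
                 real (h_weight P m) * ln (2 * t / (real m * beta_const P)))))))"
proof (intro exI[of _ 2] conjI allI impI)
  fix \<nu> :: nat and P :: "int poly" and \<Lambda> :: real
  assume hyp: "\<nu> \<ge> 2 \<and> degree P = \<nu> \<and> coeff P 0 = 0 \<and> discriminant P \<noteq> 0" and \<Lambda>: "\<Lambda> > 0"
  then have P0: "coeff P 0 = 0" "P \<noteq> 0" by auto
  define \<beta> where "\<beta> = beta_const P"
  have \<beta>: "\<beta> > 0" unfolding \<beta>_def by (rule beta_const_pos[OF P0(2)])
  \<comment> \<open>Only \<open>b > \<beta> / 4\<close> will be used, so this \<open>K\<close>
    exceeds \<open>\<Lambda> / b\<close> for all of them and the range of summation is independent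
    of \<open>b\<close>.\<close>
  define K where "K = nat \<lceil>4 * \<Lambda> / \<beta>\<rceil>"
  have K: "4 * \<Lambda> / \<beta> \<le> real K" unfolding K_def by (rule real_nat_ceiling_ge)
  define \<Phi> where "\<Phi> = (\<lambda>b e. 1 / b * (\<Sum>k=1..K. \<Sum>g | g dvd k.
    real g * (max 0 (1 - real k * b / \<Lambda>) / real g + e)\<^sup>2))"
  define L where "L = limsup (\<lambda>Q. ereal (pair_correlation P Q \<Lambda>))"
  \<comment> \<open>For fixed \<open>b\<close> below \<open>\<beta> / 2\<close> the lower bound
    \<open>b * Q^2\<close> holds for large \<open>Q\<close>, and the finite sum
    \<open>\<Phi> b (1 / Q)\<close> tends to \<open>\<Phi> b 0\<close>.\<close>
  have Lb: "L \<le> ereal (\<Phi> b 0)" if b: "\<beta> / 4 < b" "b < \<beta> / 2" for b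
  proof -
    have b0: "b > 0" using b \<beta> by simp
    have "\<Lambda> / b \<le> \<Lambda> / (\<beta> / 4)" using b \<beta> \<Lambda> by (intro divide_left_mono) auto
    also have "\<Lambda> / (\<beta> / 4) = 4 * \<Lambda> / \<beta>" by simp
    finally have bK: "\<Lambda> / b \<le> real K" using K by linarith
    have "\<forall>\<^sub>F Q in sequentially. b * (real Q)\<^sup>2 \<le> real (farey_card P Q)"
      using eventually_farey_card_ge[OF P0] b unfolding \<beta>_def by simp
    then have "\<forall>\<^sub>F Q in sequentially. ereal (pair_correlation P Q \<Lambda>) \<le> ereal (\<Phi> b (1 / real Q))"
      using eventually_gt_at_top[of 0]
    proof eventually_elim
      case (elim Q)
      then show ?case using pair_correlation_le[OF b0 elim(2) elim(1) \<Lambda> bK] by (simp add: \<Phi>_def)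
    qed
    then have "L \<le> limsup (\<lambda>Q. ereal (\<Phi> b (1 / real Q)))" unfolding L_def by (rule Limsup_mono)
    also have "(\<lambda>Q. \<Phi> b (1 / real Q)) \<longlonglongrightarrow> \<Phi> b 0"
      unfolding \<Phi>_def by (intro tendsto_intros lim_1_over_n)
    then have "limsup (\<lambda>Q. ereal (\<Phi> b (1 / real Q))) = ereal (\<Phi> b 0)"
      by (intro lim_imp_Limsup tendsto_ereal) auto
    finally show ?thesis .
  qed
  \<comment> \<open>The bound is available only for \<open>b\<close> strictly below
    \<open>\<beta> / 2\<close>; the value at \<open>\<beta> / 2\<close> is reached by continuity
    from the left, where the truncation by \<open>max 0\<close> stays continuous.\<close>
  have "((\<lambda>b. \<Phi> b 0) \<longlongrightarrow> \<Phi> (\<beta> / 2) 0) (at_left (\<beta> / 2))"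
    unfolding \<Phi>_def using \<beta> \<Lambda> by (intro tendsto_intros) auto
  then have "((\<lambda>b. ereal (\<Phi> b 0)) \<longlongrightarrow> ereal (\<Phi> (\<beta> / 2) 0)) (at_left (\<beta> / 2))"
    by (rule tendsto_ereal)
  moreover have "\<forall>\<^sub>F b in at_left (\<beta> / 2). L \<le> ereal (\<Phi> b 0)"
    using \<beta> by (intro eventually_at_leftI[of "\<beta> / 4"] Lb) auto
  ultimately have "L \<le> ereal (\<Phi> (\<beta> / 2) 0)"
    by (rule tendsto_lowerbound) simp
  also have "\<Phi> (\<beta> / 2) 0 \<le> 2 * integral {0..\<Lambda>} (\<lambda>t. 1 / t\<^sup>2 *
      (\<Sum>m | 1 \<le> m \<and> real m < 2 * t / \<beta>. real (h_weight P m) * ln (2 * t / (real m * \<beta>))))"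
  proof -
    have "2 * \<Lambda> / \<beta> \<le> 4 * \<Lambda> / \<beta>" using \<beta> \<Lambda> by (intro divide_right_mono) auto
    then have "2 * \<Lambda> / \<beta> \<le> real K" using K by linarith
    then show ?thesis
      using pair_density_integral_ge[OF \<beta> \<Lambda>, of K P] by (simp only: \<Phi>_def add_0_right)
  qed
  finally have upper: "L \<le> ereal (2 * integral {0..\<Lambda>} (\<lambda>t. 1 / t\<^sup>2 *
      (\<Sum>m | 1 \<le> m \<and> real m < 2 * t / \<beta>. real (h_weight P m) * ln (2 * t / (real m * \<beta>)))))"
    by simp
  then show "limsup (\<lambda>Q. ereal (pair_correlation P Q \<Lambda>)) \<le>
      ereal (2 * integral {0..\<Lambda>} (\<lambda>t. 1 / t\<^sup>2 *
        (\<Sum>m | 1 \<le> m \<and> real m < 2 * t / beta_const P.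
           real (h_weight P m) * ln (2 * t / (real m * beta_const P)))))"
    unfolding L_def \<beta>_def .
  have "0 \<le> L" unfolding L_def
    by (rule le_Limsup) (auto simp: pair_correlation_def)
  then show "\<bar>limsup (\<lambda>Q. ereal (pair_correlation P Q \<Lambda>))\<bar> \<noteq> \<infinity>"
    using upper unfolding L_def[symmetric] by (cases L) auto
qed simp

end
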